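(* Let $G$ be a graph on $n$ vertices, let $a$ be a positive real number, and let $$f(G;a)=\frac{\sum_{i=1}^n p(G;i)a^i}{\sum_{i=1}^n\sum_{k=i}^n p(G;k)\binom{k}{i}a^{k-i}}.$$ If $a+bi$ (with $b$ real) is a root of $\mathcal{P}(G;x)$, then $|b|\ge\min\left\{f(G;a),\ (f(G;a))^{1/n}\right\}$.
   Context: Graphs are finite and simple. For $S\subseteq V(G)$, $S$ is a power dominating set if, after coloring $S$, coloring every neighbor of a vertex of $S$, and then repeatedly applying the forcing rule (a colored vertex with exactly one uncolored neighbor colors that neighbor) until no changes occur, all vertices are colored. $p(G;i)$ is the number of power dominating sets of size $i$ and $\mathcal{P}(G;x)=\sum_{i=1}^n p(G;i)x^i$. *)

theory Defs
  imports
    "HOL-Analysis.Analysis"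
    "HOL-Computational_Algebra.Polynomial"
    "Graph_Theory.Pair_Digraph"
begin

text \<open>
  Finite simple graphs are the \<open>pair_graph\<close>s of the library: finite vertex set \<open>pverts G\<close> and a
  symmetric, irreflexive arc relation \<open>parcs G\<close> on it, each undirected edge being a pair of
  opposite arcs.
\<close>

definition neighbors :: "'v pair_pre_digraph \<Rightarrow> 'v \<Rightarrow> 'v set" where
  "neighbors G u = {v. (u, v) \<in> parcs G}"

definition force_step :: "'v pair_pre_digraph \<Rightarrow> 'v set \<Rightarrow> 'v set \<Rightarrow> bool" where
  "force_step G C C' \<longleftrightarrow> (\<exists>u\<in>C. \<exists>v. neighbors G u - C = {v} \<and> C' = insert v C)"

text \<open>
  By \<open>power_dominating_iff_stuck\<close> below, the forcing process started from a given set always stops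
  with the same colored set, so it does not matter in which order the forces are applied.
\<close>

definition power_dominating :: "'v pair_pre_digraph \<Rightarrow> 'v set \<Rightarrow> bool" where
  "power_dominating G S \<longleftrightarrow>
     S \<subseteq> pverts G \<and> (force_step G)\<^sup>*\<^sup>* (S \<union> (\<Union>u\<in>S. neighbors G u)) (pverts G)"

definition num_pds :: "'v pair_pre_digraph \<Rightarrow> nat \<Rightarrow> nat" where
  "num_pds G i = card {S. power_dominating G S \<and> card S = i}"

definition pd_poly :: "'v pair_pre_digraph \<Rightarrow> 'a::comm_semiring_1 poly" where
  "pd_poly G = (\<Sum>i=1..card (pverts G). monom (of_nat (num_pds G i)) i)"

definition pd_ratio :: "'v pair_pre_digraph \<Rightarrow> real \<Rightarrow> real" where
  "pd_ratio G a =
     (\<Sum>i=1..card (pverts G). real (num_pds G i) * a ^ i) /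
     (\<Sum>i=1..card (pverts G). \<Sum>k=i..card (pverts G).
        real (num_pds G k) * real (k choose i) * a ^ (k - i))"

lemma force_steps_subset_stuck:
  assumes "(force_step G)\<^sup>*\<^sup>* I D" "I \<subseteq> C" "\<nexists>C'. force_step G C C'"
  shows "D \<subseteq> C"
  using assms(1)
proof (induction rule: rtranclp_induct)
  case base
  show ?case by (fact assms(2))
next
  case (step D E)
  then obtain u v where uv: "u \<in> D" "neighbors G u - D = {v}" "E = insert v D"
    by (auto simp: force_step_def)
  have "v \<in> C"
  proof (rule ccontr)
    assume "v \<notin> C"
    then have "neighbors G u - C = {v}" using uv(2) step.IH by blast
    then have "force_step G C (insert v C)"
      using uv(1) step.IH unfolding force_step_def by blast
    then show False using assms(3) by blast
  qed
  then show ?case using uv(3) step.IH by simp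
qed

lemma force_steps_increasing: "(force_step G)\<^sup>*\<^sup>* I D \<Longrightarrow> I \<subseteq> D"
  by (induction rule: rtranclp_induct) (auto simp: force_step_def)

lemma neighbors_subset: "pair_graph G \<Longrightarrow> neighbors G u \<subseteq> pverts G"
  by (auto simp: neighbors_def pair_graph_def pair_digraph_def pair_fin_digraph_def
      dest: pair_wf_digraph.in_arcsD2)

lemma not_force_step_pverts: "pair_graph G \<Longrightarrow> \<not> force_step G (pverts G) C"
  using neighbors_subset[of G] unfolding force_step_def by blast

lemma power_dominating_iff_stuck:
  assumes G: "pair_graph G" and S: "S \<subseteq> pverts G"
    and run: "(force_step G)\<^sup>*\<^sup>* (S \<union> (\<Union>u\<in>S. neighbors G u)) C"
    and stuck: "\<nexists>C'. force_step G C C'"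
  shows "power_dominating G S \<longleftrightarrow> C = pverts G"
proof
  assume "power_dominating G S"
  then have PD: "(force_step G)\<^sup>*\<^sup>* (S \<union> (\<Union>u\<in>S. neighbors G u)) (pverts G)"
    by (simp add: power_dominating_def)
  have "pverts G \<subseteq> C"
    using force_steps_subset_stuck[OF PD force_steps_increasing[OF run] stuck] .
  moreover have "C \<subseteq> pverts G"
    using force_steps_subset_stuck[OF run force_steps_increasing[OF PD]]
      not_force_step_pverts[OF G] by blast
  ultimately show "C = pverts G" by simp
next
  assume "C = pverts G"
  then show "power_dominating G S" using S run by (simp add: power_dominating_def)
qed

end

theory Submission
  imports Defs
begin

text \<open>
  Expanding \<open>\<P>(G; a + bi)\<close> in powers of \<open>bi\<close>, the constant term is the numerator of \<open>f(G; a)\<close> and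
  the other coefficients add up to its denominator in modulus, because all \<open>p(G; k)\<close> are
  nonnegative. At a root the constant term is cancelled by the others, each of which carries a
  factor \<open>|b|\<^sup>i \<le> max {|b|, |b|\<^sup>n}\<close>. Hence \<open>f(G; a) \<le> max {|b|, |b|\<^sup>n}\<close>.
\<close>

text \<open>The powers of \<open>x\<close> fall with the exponent if \<open>x\<close> is at most 1
  and grow otherwise, so the largest one sits at an end of the range 1..\<open>n\<close>.\<close>

lemma power_le_max_power:
  fixes x :: "'a::linordered_semidom"
  assumes "0 \<le> x" "1 \<le> i" "i \<le> n"
  shows "x ^ i \<le> max x (x ^ n)"
proof (cases "x \<le> 1")
  case True
  then have "x ^ i \<le> x ^ 1" using assms by (intro power_decreasing) auto
  then show ?thesis by (simp add: le_max_iff_disj)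
next
  case False
  then have "x ^ i \<le> x ^ n" using assms by (intro power_increasing) auto
  then show ?thesis by (simp add: le_max_iff_disj)
qed

text \<open>Subtracting \<open>w ^ k\<close> removes the term \<open>i = 0\<close> of the binomial
  expansion, so each remaining term contains \<open>h\<close>. The factor involves \<open>n\<close>
  rather than \<open>k\<close> so that it is the same for all \<open>k\<close> and can be pulled out
  of a sum over \<open>k\<close>.\<close>

lemma norm_power_add_diff_le:
  fixes w h :: "'a::real_normed_field"
  assumes "k \<le> n"
  shows "norm ((w + h) ^ k - w ^ k) \<le>
    max (norm h) (norm h ^ n) * (\<Sum>i=1..k. real (k choose i) * norm w ^ (k - i))"
proof -
  have "(w + h) ^ k = (\<Sum>i\<le>k. of_nat (k choose i) * h ^ i * w ^ (k - i))"
    by (subst add.commute) (rule binomial_ring)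
  also have "\<dots> = w ^ k + (\<Sum>i=1..k. of_nat (k choose i) * h ^ i * w ^ (k - i))"
    by (simp add: atMost_atLeast0 sum.atLeast_Suc_atMost)
  finally have "norm ((w + h) ^ k - w ^ k) =
      norm (\<Sum>i=1..k. of_nat (k choose i) * h ^ i * w ^ (k - i))"
    by simp
  also have "\<dots> \<le> (\<Sum>i=1..k. norm h ^ i * (real (k choose i) * norm w ^ (k - i)))"
    by (rule sum_norm_le) (simp add: norm_mult norm_power mult_ac)
  also have "\<dots> \<le> (\<Sum>i=1..k. max (norm h) (norm h ^ n) *
      (real (k choose i) * norm w ^ (k - i)))"
    using assms by (intro sum_mono mult_right_mono power_le_max_power) auto
  finally show ?thesis by (simp add: sum_distrib_left)
qed

lemma sum_powers_le_at_root:
  fixes c :: "nat \<Rightarrow> real" and a b :: real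
  assumes c: "\<And>k. 0 \<le> c k" and a: "0 \<le> a"
    and root: "(\<Sum>k=1..n. of_real (c k) * Complex a b ^ k) = 0"
  shows "(\<Sum>k=1..n. c k * a ^ k) \<le>
    max \<bar>b\<bar> (\<bar>b\<bar> ^ n) * (\<Sum>i=1..n. \<Sum>k=i..n. c k * real (k choose i) * a ^ (k - i))"
proof -
  let ?M = "max \<bar>b\<bar> (\<bar>b\<bar> ^ n)"
  have z: "Complex a b = of_real a + \<i> * of_real b"
    by (simp add: complex_eq_iff)
  have "(\<Sum>k=1..n. c k * a ^ k) = norm (of_real (\<Sum>k=1..n. c k * a ^ k) :: complex)"
    using c a by (simp only: norm_of_real) (simp add: sum_nonneg)
  \<comment> \<open>Subtract the vanishing value at the root: only the differences of powers, which
    the previous lemma bounds, remain.\<close>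
  also have "of_real (\<Sum>k=1..n. c k * a ^ k) =
      - (\<Sum>k=1..n. of_real (c k) * (Complex a b ^ k - of_real a ^ k))"
    using root by (simp add: right_diff_distrib sum_subtractf)
  also have "norm \<dots> \<le>
      (\<Sum>k=1..n. c k * (?M * (\<Sum>i=1..k. real (k choose i) * a ^ (k - i))))"
    unfolding norm_minus_cancel
  proof (rule sum_norm_le)
    fix k assume "k \<in> {1..n}"
    then have "norm (Complex a b ^ k - of_real a ^ k) \<le>
        ?M * (\<Sum>i=1..k. real (k choose i) * a ^ (k - i))"
      using norm_power_add_diff_le[of k n "of_real a" "\<i> * of_real b"] a
      by (simp add: z norm_mult)
    then show "norm (of_real (c k) * (Complex a b ^ k - of_real a ^ k)) \<le>
        c k * (?M * (\<Sum>i=1..k. real (k choose i) * a ^ (k - i)))"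
      using c by (simp add: norm_mult mult_left_mono)
  qed
  also have "\<dots> = ?M * (\<Sum>k=1..n. \<Sum>i=1..k. c k * real (k choose i) * a ^ (k - i))"
    by (simp add: sum_distrib_left mult_ac)
  \<comment> \<open>Interchange summation over the triangle
    \<open>1 \<le> i \<le> k \<le> n\<close>, written as a restriction of the square to suit
    \<open>sum.swap_restrict\<close>.\<close>
  also have "(\<Sum>k=1..n. \<Sum>i=1..k. c k * real (k choose i) * a ^ (k - i)) =
      (\<Sum>k=1..n. \<Sum>i\<in>{i\<in>{1..n}. i \<le> k}. c k * real (k choose i) * a ^ (k - i))"
    by (intro sum.cong) auto
  also have "\<dots> = (\<Sum>i=1..n. \<Sum>k\<in>{k\<in>{1..n}. i \<le> k}. c k * real (k choose i) * a ^ (k - i))"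
    by (rule sum.swap_restrict) auto
  also have "\<dots> = (\<Sum>i=1..n. \<Sum>k=i..n. c k * real (k choose i) * a ^ (k - i))"
    by (intro sum.cong) auto
  finally show ?thesis .
qed

theorem theorem36:
  fixes G :: "'v pair_pre_digraph" and n :: nat and a b :: real
  assumes "pair_graph G" and "card (pverts G) = n"
    and "a > 0"
    and "poly (pd_poly G) (Complex a b) = 0"
  shows "\<bar>b\<bar> \<ge> min (pd_ratio G a) (pd_ratio G a powr (1 / real n))"
proof -
  define D where "D = (\<Sum>i=1..n. \<Sum>k=i..n. real (num_pds G k) * real (k choose i) * a ^ (k - i))"
  define N where "N = (\<Sum>i=1..n. real (num_pds G i) * a ^ i)"
  have f: "pd_ratio G a = N / D"
    by (simp add: pd_ratio_def N_def D_def assms(2))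
  have D: "0 \<le> D" and N: "0 \<le> N"
    using \<open>a > 0\<close> by (auto simp: D_def N_def intro!: sum_nonneg)
  have "(\<Sum>k=1..n. of_real (real (num_pds G k)) * Complex a b ^ k) = 0"
    using assms(4) by (simp add: pd_poly_def assms(2) poly_sum poly_monom)
  then have le: "N \<le> max \<bar>b\<bar> (\<bar>b\<bar> ^ n) * D"
    using \<open>a > 0\<close> unfolding N_def D_def by (intro sum_powers_le_at_root) auto
  show ?thesis
  \<comment> \<open>Here the ratio is 0: by the convention \<open>x / 0 = 0\<close> if
    \<open>D = 0\<close>, and because \<open>N\<close> is an empty sum if
    \<open>n = 0\<close>.\<close>
  proof (cases "D = 0 \<or> n = 0")
    case True
    then have "pd_ratio G a = 0" by (auto simp: f N_def)
    then show ?thesis by simp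
  next
    case False
    then have "N / D \<le> max \<bar>b\<bar> (\<bar>b\<bar> ^ n)"
      using D le by (simp add: pos_divide_le_eq)
    \<comment> \<open>The maximum on the right turns into the minimum of the claim: each alternative
      bounds one of its two arguments by \<open>\<bar>b\<bar>\<close>.\<close>
    then consider "N / D \<le> \<bar>b\<bar>" | "N / D \<le> \<bar>b\<bar> ^ n"
      by (auto simp: le_max_iff_disj)
    then show ?thesis
    proof cases
      case 1
      then show ?thesis by (simp add: f)
    next
      case 2
      then have "(N / D) powr (1 / real n) \<le> (\<bar>b\<bar> ^ n) powr (1 / real n)"
        using N D by (intro powr_mono2) auto
      \<comment> \<open>\<open>powr_realpow\<close> requires a positive base, so
        \<open>b = 0\<close> is separate; there \<open>n \<noteq> 0\<close> makes both sides
        0.\<close>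
      also have "\<dots> = \<bar>b\<bar>"
        using False by (cases "b = 0") (simp_all add: powr_powr flip: powr_realpow)
      finally show ?thesis by (simp add: f)
    qed
  qed
qed

end
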